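(* Let $A=\{\mathbf{a}_1,\ldots,\mathbf{a}_p\}$ and $B=\{\mathbf{b}_1,\ldots,\mathbf{b}_q\}$ be subsets of $\mathbb{N}^n$ such that the elements of $B$ lie on a line, i.e., $q\geq 2$ and there exist $\mathbf{b}\in\mathbb{N}^n$ and $u_1,\ldots,u_q\in\mathbb{N}$ with $\mathbf{b}_j=u_j\mathbf{b}$ for all $j=1,\ldots,q$. Then $\langle A\rangle$ and $\langle B\rangle$ can be glued if and only if a positive integer multiple of $\mathbf{b}$ belongs to $\langle A\rangle$, equivalently, if and only if the system $A\cdot X=d\,\mathbf{b}$ has a solution $X\in\mathbb{N}^p$ for some integer $d\ge 1$.
   Context: Here $\mathbb{N}=\{0,1,2,\ldots\}$, $n\ge 1$, and $k$ is an arbitrary field. All generators $\mathbf{a}_i,\mathbf{b}_j$ of semigroups are nonzero vectors. For $A=\{\mathbf{a}_1,\ldots,\mathbf{a}_p\}\subset\mathbb{N}^n$, $\langle A\rangle$ is the semigroup of all $\mathbb{N}$-linear combinations of elements of $A$, and $A$ also denotes the $n\times p$ integer matrix with columns $\mathbf{a}_1,\ldots,\mathbf{a}_p$. $I_A$ is the kernel of the $k$-algebra map $k[x_1,\ldots,x_p]\to k[t_1,\ldots,t_n]$, $x_j\mapsto t^{\mathbf{a}_j}=\prod_{i=1}^n t_i^{a_{ij}}$. Similarly for $B$, with variables $y_1,\ldots,y_q$ and $I_B\subset k[y_1,\ldots,y_q]$. For positive integers $k_1,k_2$ and $C=k_1A\cup k_2B$, let $I_C\subset R=k[x_1,\ldots,x_p,y_1,\ldots,y_q]$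 be the kernel of the $k$-algebra map $R\to k[t_1,\ldots,t_n]$, $x_i\mapsto t^{k_1\mathbf{a}_i}$, $y_j\mapsto t^{k_2\mathbf{b}_j}$. One says that $\langle C\rangle$ is a gluing of $\langle A\rangle$ and $\langle B\rangle$ if $I_C=I_AR+I_BR+\langle\rho\rangle$ for some nonzero binomial $\rho=x_1^{\alpha_1}\cdots x_p^{\alpha_p}-y_1^{\beta_1}\cdots y_q^{\beta_q}$ with $\alpha\in\mathbb{N}^p$, $\beta\in\mathbb{N}^q$. The semigroups $\langle A\rangle$ and $\langle B\rangle$ can be glued if there exist positive integers $k_1,k_2$ such that, for $C=k_1A\cup k_2B$, $\langle C\rangle$ is a gluing of $\langle A\rangle$ and $\langle B\rangle$. *)

theory Defs
  imports "HOL-Analysis.Analysis" "HOL-Library.Poly_Mapping" "HOL-Library.Set_Algebras"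
begin

text \<open>
  The polynomial ring over \<open>'k\<close> in finitely many variables, one for each element of the
  finite type \<open>'v\<close>: finitely supported maps from exponents to coefficients, with the
  convolution product of \<open>Poly_Mapping\<close>. The rings in \<open>x\<^sub>1,\<dots>,x\<^sub>p\<close>, in \<open>y\<^sub>1,\<dots>,y\<^sub>q\<close> and in
  \<open>t\<^sub>1,\<dots>,t\<^sub>n\<close> are \<open>('p,'k) mpoly\<close>, \<open>('q,'k) mpoly\<close> and \<open>('n,'k) mpoly\<close>. The ring \<open>R\<close> is
  \<open>('p + 'q,'k) mpoly\<close>, with \<open>x\<^sub>i = Var (Inl i)\<close> and \<open>y\<^sub>j = Var (Inr j)\<close>.
\<close>
type_synonym ('v, 'k) mpoly = "('v \<Rightarrow>\<^sub>0 nat) \<Rightarrow>\<^sub>0 'k"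

definition Const :: "'k::field \<Rightarrow> ('v, 'k) mpoly"
  where "Const c = Poly_Mapping.single 0 c"

definition Var :: "'v \<Rightarrow> ('v, 'k::field) mpoly"
  where "Var i = Poly_Mapping.single (Poly_Mapping.single i 1) 1"

text \<open>The \<open>k\<close>-algebra homomorphism that sends each variable \<open>Var i\<close> to \<open>f i\<close>.\<close>
definition alg_hom ::
    "('v::finite \<Rightarrow> ('w, 'k::field) mpoly) \<Rightarrow> ('v, 'k) mpoly \<Rightarrow> ('w, 'k) mpoly"
  where "alg_hom f P =
    (\<Sum>m\<in>Poly_Mapping.keys P.
       Const (Poly_Mapping.lookup P m) * (\<Prod>i\<in>UNIV. f i ^ Poly_Mapping.lookup m i))"

definition ideal_gen :: "'a::comm_ring_1 set \<Rightarrow> 'a set"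
  where "ideal_gen S = module.span (*) S"

text \<open>\<open>I\<^sub>A\<close> for a family \<open>a\<close> of generators: the kernel of \<open>x\<^sub>j \<mapsto> t\<^bsup>a j\<^esup>\<close>.\<close>
definition toric_ideal :: "('v::finite \<Rightarrow> nat ^ 'n) \<Rightarrow> ('v, 'k::field) mpoly set"
  where "toric_ideal a = {P. alg_hom (\<lambda>j. \<Prod>i\<in>UNIV. Var i ^ (a j $ i)) P = 0}"

text \<open>\<open>\<langle>S\<rangle>\<close> for a finite set \<open>S\<close> of vectors.\<close>
definition semigroup_gen :: "(nat ^ 'n) set \<Rightarrow> (nat ^ 'n) set"
  where "semigroup_gen S = {\<Sum>v\<in>S. c v *s v | c :: nat ^ 'n \<Rightarrow> nat. True}"

text \<open>
  The generators are the columns of \<open>A\<close> and \<open>B\<close>. The family of generators of \<open>C = k\<^sub>1A \<union> k\<^sub>2B\<close>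
  is indexed by \<open>'p + 'q\<close>, so a vector common to \<open>k\<^sub>1A\<close> and \<open>k\<^sub>2B\<close> keeps its two variables.
  The sums of ideals are elementwise sums of sets. The field is passed as a type argument.
\<close>
definition is_gluing ::
    "'k::field itself \<Rightarrow> nat \<Rightarrow> nat \<Rightarrow> nat ^ 'p ^ 'n \<Rightarrow> nat ^ 'q ^ 'n \<Rightarrow> bool"
  where "is_gluing _ k1 k2 A B \<longleftrightarrow>
    (\<exists>(\<alpha> :: 'p \<Rightarrow> nat) (\<beta> :: 'q \<Rightarrow> nat) (\<rho> :: ('p + 'q, 'k) mpoly).
       \<rho> = (\<Prod>i\<in>UNIV. Var (Inl i) ^ \<alpha> i) - (\<Prod>j\<in>UNIV. Var (Inr j) ^ \<beta> j) \<and>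
       \<rho> \<noteq> 0 \<and>
       toric_ideal (case_sum (\<lambda>i. k1 *s column i A) (\<lambda>j. k2 *s column j B)) =
         ideal_gen (alg_hom (\<lambda>i. Var (Inl i)) ` toric_ideal (\<lambda>i. column i A)) +
         ideal_gen (alg_hom (\<lambda>j. Var (Inr j)) ` toric_ideal (\<lambda>j. column j B)) +
         ideal_gen {\<rho>})"

definition can_be_glued :: "'k::field itself \<Rightarrow> nat ^ 'p ^ 'n \<Rightarrow> nat ^ 'q ^ 'n \<Rightarrow> bool"
  where "can_be_glued K A B \<longleftrightarrow> (\<exists>k1 k2. k1 \<ge> 1 \<and> k2 \<ge> 1 \<and> is_gluing K k1 k2 A B)"

end

theory Submission
  imports Defs
begin

text \<open>
  A gluing binomial \<open>\<rho> = x\<^sup>\<alpha> - y\<^sup>\<beta>\<close> lies in \<open>I\<^sub>C\<close>, so \<open>k\<^sub>1 A\<alpha> = k\<^sub>2 B\<beta>\<close> is a multiple of \<open>b\<close> in \<open>\<langle>A\<rangle>\<close>,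
  nonzero because the generators are nonzero and \<open>\<rho> \<noteq> 0\<close>.

  Conversely, let \<open>AX = d b\<close> with \<open>d \<ge> 1\<close>, and let \<open>g\<close> be the gcd of the \<open>u\<^sub>j\<close>. Fix a coordinate \<open>i\<^sub>0\<close>
  with \<open>b\<^sub>i\<^sub>0 > 0\<close> and choose \<open>\<beta>\<close> with \<open>\<Sum> \<beta>\<^sub>j u\<^sub>j = N g\<close>, where \<open>N > 0\<close> is coprime to \<open>d b\<^sub>i\<^sub>0\<close>. Take
  \<open>k\<^sub>1 = N g\<close>, \<open>k\<^sub>2 = d\<close> and \<open>\<rho> = x\<^sup>X - y\<^sup>\<beta>\<close>. As \<open>I\<^sub>C\<close> is generated by binomials, consider one of
  them, that is, a relation \<open>k\<^sub>1 A(x - x') = k\<^sub>2 B(y' - y)\<close>. It reads \<open>N A(x - x') = m d b\<close> for an integer \<open>m\<close>;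
  the coordinate \<open>i\<^sub>0\<close> gives \<open>N dvd m\<close>, so for some integer \<open>l\<close> we have \<open>A(x - x') = l AX\<close> and
  \<open>B(y' - y) = l B\<beta>\<close>. The binomial is then a combination of elements of \<open>I\<^sub>A\<close> and \<open>I\<^sub>B\<close> and
  of \<open>(x\<^sup>X)\<^sup>l - (y\<^sup>\<beta>)\<^sup>l\<close>, a multiple of \<open>\<rho>\<close>.
\<close>

section \<open>Monomials with natural exponent functions\<close>

abbreviation expo :: "('v::finite \<Rightarrow> nat) \<Rightarrow> 'v \<Rightarrow>\<^sub>0 nat"
  where "expo \<equiv> Abs_poly_mapping"

abbreviation monomial :: "('v::finite \<Rightarrow> nat) \<Rightarrow> ('v, 'k::field) mpoly"
  where "monomial e \<equiv> Poly_Mapping.single (expo e) 1"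

text \<open>On a finite index type every function has finite support, so \<open>expo\<close> loses
  no information.\<close>

lemma lookup_expo [simp]: "Poly_Mapping.lookup (expo e) = e"
  by (simp add: Abs_poly_mapping_inverse)

lemma expo_lookup [simp]: "expo (Poly_Mapping.lookup m) = m"
  by (simp add: lookup_inverse)

lemma monomial_mult: "monomial e * monomial e' = (monomial (\<lambda>v. e v + e' v) :: ('v::finite, 'k::field) mpoly)"
proof -
  have "expo e + expo e' = expo (\<lambda>v. e v + e' v)"
    by (rule poly_mapping_eqI) (simp add: lookup_add)
  then show ?thesis by (simp add: mult_single)
qed

lemma monomial_zero: "monomial (\<lambda>_. 0) = (1 :: ('v::finite, 'k::field) mpoly)"
proof -
  have "expo (\<lambda>_. 0 :: nat) = (0 :: 'v \<Rightarrow>\<^sub>0 nat)"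
    by (rule poly_mapping_eqI) simp
  then show ?thesis by simp
qed

lemma monomial_power: "monomial e ^ k = (monomial (\<lambda>v. k * e v) :: ('v::finite, 'k::field) mpoly)"
  by (induction k) (simp_all add: monomial_zero monomial_mult algebra_simps)

lemma monomial_prod:
  "(\<Prod>i\<in>S. monomial (e i)) = (monomial (\<lambda>v. \<Sum>i\<in>S. e i v) :: ('v::finite, 'k::field) mpoly)"
  by (induction S rule: infinite_finite_induct) (simp_all add: monomial_zero monomial_mult)

lemma monomial_inj: "monomial e = (monomial e' :: ('v::finite, 'k::field) mpoly) \<longleftrightarrow> e = e'"
proof
  assume eq: "monomial e = (monomial e' :: ('v, 'k) mpoly)"
  have "Poly_Mapping.keys (monomial e :: ('v, 'k) mpoly) = Poly_Mapping.keys (monomial e' :: ('v, 'k) mpoly)"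
    by (simp only: eq)
  then have "expo e = expo e'" by simp
  then show "e = e'" by (metis lookup_expo)
qed simp

lemma Var_eq_monomial: "Var i = monomial (\<lambda>v. if v = i then 1 else 0)"
proof -
  have "Poly_Mapping.single i 1 = expo (\<lambda>v. if v = i then 1 else 0)"
    by (rule poly_mapping_eqI) (simp add: lookup_single when_def)
  then show ?thesis by (simp add: Var_def)
qed

text \<open>The renaming \<open>h\<close> covers the plain variables and both injections into the
  variables of R at once.\<close>

lemma prod_Var_power:
  fixes h :: "'v::finite \<Rightarrow> 'w::finite"
  shows "(\<Prod>i\<in>UNIV. Var (h i) ^ e i) =
    (monomial (\<lambda>v. \<Sum>i\<in>UNIV. e i * (if v = h i then 1 else 0)) :: ('w, 'k::field) mpoly)"
  by (simp only: Var_eq_monomial monomial_power monomial_prod)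

lemma prod_Var: "(\<Prod>i\<in>UNIV. Var i ^ e i) = (monomial e :: ('v::finite, 'k::field) mpoly)"
  by (simp add: prod_Var_power if_distrib cong: if_cong)

lemma prod_Var_Inl: "(\<Prod>i\<in>UNIV. Var (Inl i) ^ e i) =
    (monomial (case_sum e (\<lambda>_. 0)) :: ('p::finite + 'q::finite, 'k::field) mpoly)"
  unfolding prod_Var_power
  by (rule arg_cong[where f = monomial]) (auto simp: fun_eq_iff if_distrib split: sum.split cong: if_cong)

lemma prod_Var_Inr: "(\<Prod>i\<in>UNIV. Var (Inr i) ^ e i) =
    (monomial (case_sum (\<lambda>_. 0) e) :: ('p::finite + 'q::finite, 'k::field) mpoly)"
  unfolding prod_Var_power
  by (rule arg_cong[where f = monomial]) (auto simp: fun_eq_iff if_distrib split: sum.split cong: if_cong)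

section \<open>Algebra homomorphisms\<close>

text \<open>Extra exponents contribute zero coefficients; a common index set then makes additivity a
  termwise computation.\<close>

lemma alg_hom_superset:
  assumes "finite S" "Poly_Mapping.keys P \<subseteq> S"
  shows "alg_hom f P =
    (\<Sum>m\<in>S. Const (Poly_Mapping.lookup P m) * (\<Prod>i\<in>UNIV. f i ^ Poly_Mapping.lookup m i))"
  unfolding alg_hom_def
  by (rule sum.mono_neutral_left) (use assms in \<open>auto simp: Const_def in_keys_iff\<close>)

lemma Const_add: "Const (a + b) = Const a + Const b"
  by (simp add: Const_def single_add)

lemma Const_mult: "Const (a * b) = Const a * Const b"
  by (simp add: Const_def mult_single)

lemma alg_hom_add: "alg_hom f (P + Q) = alg_hom f P + alg_hom f Q"
proof -
  let ?S = "Poly_Mapping.keys P \<union> Poly_Mapping.keys Q"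
  have "Poly_Mapping.keys (P + Q) \<subseteq> ?S" by (rule Poly_Mapping.keys_add)
  then show ?thesis
    by (simp add: alg_hom_superset[of ?S] lookup_add Const_add distrib_right sum.distrib)
qed

lemma alg_hom_zero [simp]: "alg_hom f 0 = 0"
  by (simp add: alg_hom_def)

lemma alg_hom_diff: "alg_hom f (P - Q) = alg_hom f P - alg_hom f Q"
  using alg_hom_add[of f "P - Q" Q] by simp

lemma alg_hom_sum: "alg_hom f (\<Sum>i\<in>S. P i) = (\<Sum>i\<in>S. alg_hom f (P i))"
  by (induction S rule: infinite_finite_induct) (simp_all add: alg_hom_add)

lemma alg_hom_single:
  "alg_hom f (Poly_Mapping.single m c) = Const c * (\<Prod>i\<in>UNIV. f i ^ Poly_Mapping.lookup m i)"
  by (simp add: alg_hom_superset[of "{m}"])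

lemma sum_single_lookup:
  "(\<Sum>m\<in>Poly_Mapping.keys P. Poly_Mapping.single m (Poly_Mapping.lookup P m)) = P"
  by (rule poly_mapping_eqI) (simp add: Poly_Mapping.lookup_sum lookup_single when_def in_keys_iff)

lemma alg_hom_mult: "alg_hom f (P * Q) = alg_hom f P * alg_hom f Q"
proof -
  \<comment> \<open>Multiplicativity is checked on single terms and carried over by expanding both
    factors into terms.\<close>
  have *: "alg_hom f (Poly_Mapping.single m c * Poly_Mapping.single m' c') =
    alg_hom f (Poly_Mapping.single m c) * alg_hom f (Poly_Mapping.single m' c')" for m m' c c'
    by (simp add: mult_single alg_hom_single lookup_add power_add prod.distrib Const_mult)
  have "alg_hom f (P * Q) = alg_hom f
    ((\<Sum>m\<in>Poly_Mapping.keys P. Poly_Mapping.single m (Poly_Mapping.lookup P m)) *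
     (\<Sum>m\<in>Poly_Mapping.keys Q. Poly_Mapping.single m (Poly_Mapping.lookup Q m)))"
    by (simp only: sum_single_lookup)
  also have "\<dots> =
    alg_hom f (\<Sum>m\<in>Poly_Mapping.keys P. Poly_Mapping.single m (Poly_Mapping.lookup P m)) *
    alg_hom f (\<Sum>m\<in>Poly_Mapping.keys Q. Poly_Mapping.single m (Poly_Mapping.lookup Q m))"
    by (simp only: sum_product alg_hom_sum *)
  finally show ?thesis by (simp only: sum_single_lookup)
qed

section \<open>Generated ideals as spans over the ring itself\<close>

lemma module_mult: "module ((*) :: 'a::comm_ring_1 \<Rightarrow> 'a \<Rightarrow> 'a)"
  by unfold_locales (simp_all add: algebra_simps)

lemma ideal_gen_base: "x \<in> S \<Longrightarrow> x \<in> ideal_gen S"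
  unfolding ideal_gen_def by (rule module.span_base[OF module_mult])

lemma ideal_gen_mult: "x \<in> ideal_gen S \<Longrightarrow> c * x \<in> ideal_gen S"
  unfolding ideal_gen_def by (rule module.span_scale[OF module_mult])

lemma ideal_gen_add: "x \<in> ideal_gen S \<Longrightarrow> y \<in> ideal_gen S \<Longrightarrow> x + y \<in> ideal_gen S"
  unfolding ideal_gen_def by (rule module.span_add[OF module_mult])

lemma ideal_gen_sum: "(\<And>i. i \<in> I \<Longrightarrow> x i \<in> ideal_gen S) \<Longrightarrow> (\<Sum>i\<in>I. x i) \<in> ideal_gen S"
  unfolding ideal_gen_def by (rule module.span_sum[OF module_mult])

lemma ideal_gen_least:
  assumes "S \<subseteq> J" "0 \<in> J" "\<And>x y. x \<in> J \<Longrightarrow> y \<in> J \<Longrightarrow> x + y \<in> J" "\<And>c x. x \<in> J \<Longrightarrow> c * x \<in> J"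
  shows "ideal_gen S \<subseteq> J"
  unfolding ideal_gen_def
  by (rule module.span_minimal[OF module_mult])
     (use assms in \<open>auto simp: module.subspace_def[OF module_mult]\<close>)

lemma ideal_gen_Un: "ideal_gen (S \<union> T) = ideal_gen S + ideal_gen T"
  unfolding ideal_gen_def module.span_Un[OF module_mult] set_plus_def by blast

section \<open>Multidegrees and binomial generators of toric ideals\<close>

text \<open>This is the exponent of t in the image of the monomial with exponent \<open>e\<close>,
  that is, the matrix product Ae.\<close>

definition vdeg :: "('v::finite \<Rightarrow> nat ^ 'n) \<Rightarrow> ('v \<Rightarrow> nat) \<Rightarrow> nat ^ 'n"
  where "vdeg a e = (\<Sum>j\<in>UNIV. e j *s a j)"

lemma vdeg_nth: "vdeg a e $ i = (\<Sum>j\<in>UNIV. e j * a j $ i)"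
  by (simp add: vdeg_def)

abbreviation tmap :: "('v::finite \<Rightarrow> nat ^ 'n) \<Rightarrow> ('v, 'k::field) mpoly \<Rightarrow> ('n, 'k) mpoly"
  where "tmap a \<equiv> alg_hom (\<lambda>j. \<Prod>i\<in>UNIV. Var i ^ (a j $ i))"

lemma tmap_single:
  "tmap a (Poly_Mapping.single m c) = (Const c * monomial (($) (vdeg a (Poly_Mapping.lookup m))))"
  by (simp add: alg_hom_single prod_Var monomial_power monomial_prod vdeg_nth[abs_def])

lemma tmap_monomial: "tmap a (monomial e :: ('v::finite, 'k::field) mpoly) = monomial (($) (vdeg a e))"
  by (simp add: tmap_single Const_def mult_single)

lemma monomial_vec_inj: "monomial (($) x) = (monomial (($) y) :: ('n::finite, 'k::field) mpoly) \<longleftrightarrow> x = y"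
  by (simp add: monomial_inj vec_eq_iff fun_eq_iff)

lemma monomial_diff_in_toric_ideal:
  "(monomial e - monomial e' :: ('v::finite, 'k::field) mpoly) \<in> toric_ideal a \<longleftrightarrow> vdeg a e = vdeg a e'"
  by (simp add: toric_ideal_def alg_hom_diff tmap_monomial monomial_vec_inj)

lemma toric_ideal_ideal_gen: "S \<subseteq> toric_ideal a \<Longrightarrow> ideal_gen S \<subseteq> toric_ideal a"
  by (rule ideal_gen_least) (auto simp: toric_ideal_def alg_hom_add alg_hom_mult)

lemma toric_ideal_binomials:
  "toric_ideal a =
    ideal_gen {monomial e - monomial e' :: ('v::finite, 'k::field) mpoly | e e'. vdeg a e = vdeg a e'}"
    (is "_ = ideal_gen ?S")
proof
  show "ideal_gen ?S \<subseteq> toric_ideal a"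
    by (rule toric_ideal_ideal_gen) (auto simp: monomial_diff_in_toric_ideal)
  show "toric_ideal a \<subseteq> ideal_gen ?S"
  proof
    fix P :: "('v, 'k) mpoly" assume P: "P \<in> toric_ideal a"
    txt \<open>
      Replacing each monomial by a representative \<open>r\<close> of its degree changes \<open>P\<close> by binomials; the
      result is zero, since the coefficients of \<open>P\<close> in each degree add up to zero.
    \<close>
    let ?K = "Poly_Mapping.keys P"
    define d where "d m = vdeg a (Poly_Mapping.lookup m)" for m
    \<comment> \<open>The choice is meaningful only for degrees that occur; \<open>r\<close> is used
      only at such degrees \<open>d m\<close>.\<close>
    define r where "r w = (SOME e. vdeg a e = w)" for w
    have r: "vdeg a (r (d m)) = d m" for m
      unfolding r_def by (rule someI[of _ "Poly_Mapping.lookup m"]) (simp add: d_def)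
    have coeff: "(\<Sum>m\<in>{m\<in>?K. d m = w}. Poly_Mapping.lookup P m) = 0" for w
    proof -
      \<comment> \<open>The sum in question is the coefficient of t^w in the image of
        \<open>P\<close>.\<close>
      have "0 = Poly_Mapping.lookup (tmap a P) (expo (($) w))"
        using P by (simp add: toric_ideal_def)
      also have "tmap a P = (\<Sum>m\<in>?K. Poly_Mapping.single (expo (($) (d m))) (Poly_Mapping.lookup P m))"
        by (subst sum_single_lookup[of P, symmetric])
           (simp only: alg_hom_sum tmap_single d_def Const_def mult_single add_0 mult_1_right)
      also have "Poly_Mapping.lookup \<dots> (expo (($) w)) =
          (\<Sum>m\<in>?K. if d m = w then Poly_Mapping.lookup P m else 0)"
      proof -
        have "expo (($) x) = expo (($) w) \<longleftrightarrow> x = w" for x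
          by (metis lookup_expo vec_eq_iff)
        then show ?thesis
          by (simp add: Poly_Mapping.lookup_sum lookup_single when_def)
      qed
      finally show ?thesis by (simp add: sum.inter_filter)
    qed
    \<comment> \<open>Within one degree the representative is constant, so it factors out and leaves
      a coefficient sum that vanishes by \<open>coeff\<close>.\<close>
    have "(\<Sum>m\<in>?K. Const (Poly_Mapping.lookup P m) * monomial (r (d m)) :: ('v, 'k) mpoly) =
        (\<Sum>w\<in>d ` ?K. \<Sum>m\<in>{m\<in>?K. d m = w}. Const (Poly_Mapping.lookup P m) * monomial (r (d m)))"
      by (rule sum.image_gen) simp
    also have "\<dots> = (\<Sum>w\<in>d ` ?K. Const (\<Sum>m\<in>{m\<in>?K. d m = w}. Poly_Mapping.lookup P m) * monomial (r w))"
    proof (rule sum.cong[OF refl])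
      fix w
      have "Const (\<Sum>m\<in>M. Poly_Mapping.lookup P m) = (\<Sum>m\<in>M. Const (Poly_Mapping.lookup P m) :: ('v, 'k) mpoly)" for M
        by (induction M rule: infinite_finite_induct) (simp_all add: Const_add, simp_all add: Const_def)
      then show "(\<Sum>m\<in>{m\<in>?K. d m = w}. Const (Poly_Mapping.lookup P m) * monomial (r (d m)) :: ('v, 'k) mpoly) =
        Const (\<Sum>m\<in>{m\<in>?K. d m = w}. Poly_Mapping.lookup P m) * monomial (r w)"
        by (simp add: sum_distrib_right)
    qed
    also have "\<dots> = 0" by (simp only: coeff) (simp add: Const_def)
    finally have zero: "(\<Sum>m\<in>?K. Const (Poly_Mapping.lookup P m) * monomial (r (d m)) :: ('v, 'k) mpoly) = 0" .
    have "P = (\<Sum>m\<in>?K. Const (Poly_Mapping.lookup P m) * monomial (Poly_Mapping.lookup m))"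
      by (simp add: Const_def mult_single sum_single_lookup)
    then have "P = (\<Sum>m\<in>?K. Const (Poly_Mapping.lookup P m) * (monomial (Poly_Mapping.lookup m) - monomial (r (d m))))"
      by (simp only: right_diff_distrib sum_subtractf zero diff_zero)
    also have "\<dots> \<in> ideal_gen ?S"
    proof (intro ideal_gen_sum ideal_gen_mult ideal_gen_base)
      fix m
      have "vdeg a (Poly_Mapping.lookup m) = vdeg a (r (d m))" unfolding r by (simp only: d_def)
      then show "monomial (Poly_Mapping.lookup m) - monomial (r (d m)) \<in> ?S" by blast
    qed
    finally show "P \<in> ideal_gen ?S" .
  qed
qed

section \<open>Toric ideals in the joint polynomial ring\<close>

lemma alg_hom_Inl_monomial: "alg_hom (\<lambda>i. Var (Inl i)) (monomial e) =
    (monomial (case_sum e (\<lambda>_. 0)) :: ('p::finite + 'q::finite, 'k::field) mpoly)"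
  by (simp add: alg_hom_single prod_Var_Inl Const_def mult_single)

lemma alg_hom_Inr_monomial: "alg_hom (\<lambda>i. Var (Inr i)) (monomial e) =
    (monomial (case_sum (\<lambda>_. 0) e) :: ('p::finite + 'q::finite, 'k::field) mpoly)"
  by (simp add: alg_hom_single prod_Var_Inr Const_def mult_single)

lemma vdeg_scale: "vdeg (\<lambda>j. k *s a j) e = k *s vdeg a e"
  by (simp add: vec_eq_iff vdeg_nth sum_distrib_left mult.left_commute)

lemma vdeg_zero [simp]: "vdeg a (\<lambda>_. 0) = 0"
  by (simp add: vec_eq_iff vdeg_nth)

lemma vdeg_add_mult: "vdeg a (\<lambda>v. e v + l * e' v) = vdeg a e + l *s vdeg a e'"
  by (simp add: vec_eq_iff vdeg_nth sum_distrib_left distrib_right sum.distrib mult.assoc)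

lemma vdeg_case_sum: "vdeg (case_sum a c) (case_sum e f) = vdeg a e + vdeg c f"
  unfolding vdeg_def UNIV_Plus_UNIV[symmetric] by (subst sum.Plus) auto

text \<open>Natural numbers admit no cancellation, so each summand vanishes, and each
  \<open>a j\<close> has a nonzero coordinate.\<close>

lemma vdeg_eq_0_iff:
  assumes "\<And>i. a i \<noteq> 0"
  shows "vdeg a e = 0 \<longleftrightarrow> e = (\<lambda>_. 0)"
proof
  assume "vdeg a e = 0"
  then have "e j * a j $ i = 0" for i j
    by (simp add: vec_eq_iff vdeg_nth)
  moreover have "\<exists>i. a j $ i \<noteq> 0" for j
    using assms[of j] by (simp add: vec_eq_iff)
  ultimately show "e = (\<lambda>_. 0)" by (metis mult_eq_0_iff)
qed simp

text \<open>The preimage of an ideal under a homomorphism is an ideal, so testing the binomial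
  generators is enough.\<close>

lemma alg_hom_toric_ideal_subset:
  fixes h :: "'v::finite \<Rightarrow> ('w::finite, 'k::field) mpoly"
  assumes "\<And>e e'. vdeg a e = vdeg a e' \<Longrightarrow>
    alg_hom h (monomial e - monomial e') \<in> toric_ideal c"
  shows "alg_hom h ` toric_ideal a \<subseteq> toric_ideal c"
proof -
  have "ideal_gen {monomial e - monomial e' | e e'. vdeg a e = vdeg a e'} \<subseteq>
      {P. alg_hom h P \<in> toric_ideal c}"
    by (rule ideal_gen_least) (use assms in \<open>auto simp: toric_ideal_def alg_hom_add alg_hom_mult\<close>)
  then show ?thesis by (auto simp: toric_ideal_binomials)
qed

text \<open>The path from \<open>x * y\<close> to \<open>x' * y'\<close> goes through
  \<open>x' * p * y\<close> and \<open>x' * y * q\<close>. With \<open>p\<close> and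
  \<open>q\<close> the l-th powers of the two monomials of \<rho>, the three differences belong to
  the A-part, to \<rho> and to the B-part.\<close>

lemma product_diff_telescope:
  "x * y - x' * y' = y * (x - x' * p) + (x' * y) * (p - q) + x' * (y * q - y')"
  for x :: "'a::comm_ring_1"
  by (simp add: algebra_simps)

text \<open>The hypothesis \<open>rels\<close> says that each relation of C-degrees is l times the
  relation of \<rho>, up to relations of A and of B separately. Since l is natural, the two
  directions of the exchange are separate alternatives.\<close>

lemma toric_ideal_gluing:
  fixes a :: "'p::finite \<Rightarrow> nat ^ 'n" and c :: "'q::finite \<Rightarrow> nat ^ 'n"
    and \<alpha> :: "'p \<Rightarrow> nat" and \<beta> :: "'q \<Rightarrow> nat" and \<rho> :: "('p + 'q, 'k::field) mpoly"
  assumes \<rho>: "\<rho> = monomial (case_sum \<alpha> (\<lambda>_. 0)) - monomial (case_sum (\<lambda>_. 0) \<beta>)"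
    and rel: "k1 *s vdeg a \<alpha> = k2 *s vdeg c \<beta>"
    and rels: "\<And>x x' y y'. k1 *s vdeg a x + k2 *s vdeg c y = k1 *s vdeg a x' + k2 *s vdeg c y' \<Longrightarrow>
      \<exists>l. vdeg a x = vdeg a x' + l *s vdeg a \<alpha> \<and> vdeg c y' = vdeg c y + l *s vdeg c \<beta> \<or>
          vdeg a x' = vdeg a x + l *s vdeg a \<alpha> \<and> vdeg c y = vdeg c y' + l *s vdeg c \<beta>"
  shows "toric_ideal (case_sum (\<lambda>i. k1 *s a i) (\<lambda>j. k2 *s c j)) =
    ideal_gen (alg_hom (\<lambda>i. Var (Inl i)) ` toric_ideal a) +
    ideal_gen (alg_hom (\<lambda>j. Var (Inr j)) ` toric_ideal c) + ideal_gen {\<rho>}"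
    (is "toric_ideal ?C = ideal_gen ?SA + ideal_gen ?SB + _")
proof -
  have deg: "vdeg ?C (case_sum x y) = k1 *s vdeg a x + k2 *s vdeg c y" for x y
    by (simp add: vdeg_case_sum vdeg_scale)
  let ?G = "?SA \<union> ?SB \<union> {\<rho>}"
  let ?X = "\<lambda>x. monomial (case_sum x (\<lambda>_. 0)) :: ('p + 'q, 'k) mpoly"
  let ?Y = "\<lambda>y. monomial (case_sum (\<lambda>_. 0) y) :: ('p + 'q, 'k) mpoly"
  have split: "monomial e = ?X (\<lambda>i. e (Inl i)) * ?Y (\<lambda>j. e (Inr j))" for e
    unfolding monomial_mult by (rule arg_cong[where f = monomial]) (auto simp: fun_eq_iff split: sum.split)
  have X_add: "?X (\<lambda>v. x v + l * x' v) = ?X x * ?X x' ^ l" for x x' l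
    unfolding monomial_mult monomial_power
    by (rule arg_cong[where f = monomial]) (auto simp: fun_eq_iff split: sum.split)
  have Y_add: "?Y (\<lambda>v. x v + l * x' v) = ?Y x * ?Y x' ^ l" for x x' l
    unfolding monomial_mult monomial_power
    by (rule arg_cong[where f = monomial]) (auto simp: fun_eq_iff split: sum.split)
  have X_in: "?X x - ?X x' \<in> ideal_gen ?G" if "vdeg a x = vdeg a x'" for x x'
  proof -
    have "monomial x - monomial x' \<in> toric_ideal a"
      using that by (simp add: monomial_diff_in_toric_ideal)
    moreover have "?X x - ?X x' = alg_hom (\<lambda>i. Var (Inl i)) (monomial x - monomial x')"
      by (simp add: alg_hom_diff alg_hom_Inl_monomial)
    ultimately show ?thesis by (intro ideal_gen_base) blast
  qed
  have Y_in: "?Y y - ?Y y' \<in> ideal_gen ?G" if "vdeg c y = vdeg c y'" for y y'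
  proof -
    have "monomial y - monomial y' \<in> toric_ideal c"
      using that by (simp add: monomial_diff_in_toric_ideal)
    moreover have "?Y y - ?Y y' = alg_hom (\<lambda>i. Var (Inr i)) (monomial y - monomial y')"
      by (simp add: alg_hom_diff alg_hom_Inr_monomial)
    ultimately show ?thesis by (intro ideal_gen_base) blast
  qed
  have \<rho>_in: "?X \<alpha> ^ l - ?Y \<beta> ^ l \<in> ideal_gen ?G" for l
  proof -
    have "\<rho> \<in> ideal_gen ?G" by (rule ideal_gen_base) simp
    \<comment> \<open>A difference of l-th powers is divisible by the difference of the bases, which
      is \<rho>.\<close>
    then show ?thesis
      unfolding power_diff_sumr2 \<rho>[symmetric] by (subst mult.commute) (rule ideal_gen_mult)
  qed
  have move: "?X x * ?Y y - ?X x' * ?Y y' \<in> ideal_gen ?G"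
    if "vdeg a x = vdeg a x' + l *s vdeg a \<alpha>" "vdeg c y' = vdeg c y + l *s vdeg c \<beta>" for x x' y y' l
  proof -
    have "?X x * ?Y y - ?X x' * ?Y y' =
        ?Y y * (?X x - ?X (\<lambda>v. x' v + l * \<alpha> v)) + (?X x' * ?Y y) * (?X \<alpha> ^ l - ?Y \<beta> ^ l)
        + ?X x' * (?Y (\<lambda>v. y v + l * \<beta> v) - ?Y y')"
      unfolding X_add Y_add by (rule product_diff_telescope)
    also have "\<dots> \<in> ideal_gen ?G"
      using that by (intro ideal_gen_add ideal_gen_mult X_in Y_in \<rho>_in) (simp_all only: vdeg_add_mult)
    finally show ?thesis .
  qed
  have "toric_ideal ?C \<subseteq> ideal_gen ?G"
    unfolding toric_ideal_binomials[of ?C]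
  proof (rule ideal_gen_least)
    show "{monomial e - monomial e' | e e'. vdeg ?C e = vdeg ?C e'} \<subseteq> ideal_gen ?G"
    proof clarify
      fix e e' :: "'p + 'q \<Rightarrow> nat" assume eq: "vdeg ?C e = vdeg ?C e'"
      define x y x' y' where "x = (\<lambda>i. e (Inl i))" and "y = (\<lambda>j. e (Inr j))"
        and "x' = (\<lambda>i. e' (Inl i))" and "y' = (\<lambda>j. e' (Inr j))"
      note xy = this
      have "e = case_sum x y" "e' = case_sum x' y'"
        by (auto simp: xy fun_eq_iff split: sum.split)
      with eq have "k1 *s vdeg a x + k2 *s vdeg c y = k1 *s vdeg a x' + k2 *s vdeg c y'"
        by (simp only: deg)
      then obtain l where l: "vdeg a x = vdeg a x' + l *s vdeg a \<alpha> \<and> vdeg c y' = vdeg c y + l *s vdeg c \<beta> \<or>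
          vdeg a x' = vdeg a x + l *s vdeg a \<alpha> \<and> vdeg c y = vdeg c y' + l *s vdeg c \<beta>"
        using rels by blast
      have "?X x * ?Y y - ?X x' * ?Y y' \<in> ideal_gen ?G"
        using l
      proof
        \<comment> \<open>This is the other direction of \<open>move\<close>, with the two monomials
          interchanged and the sign corrected.\<close>
        assume "vdeg a x' = vdeg a x + l *s vdeg a \<alpha> \<and> vdeg c y = vdeg c y' + l *s vdeg c \<beta>"
        then have "(-1) * (?X x' * ?Y y' - ?X x * ?Y y) \<in> ideal_gen ?G"
          by (intro ideal_gen_mult move) auto
        then show ?thesis by simp
      qed (intro move, auto)
      then show "monomial e - monomial e' \<in> ideal_gen ?G"
        by (simp only: split[of e] split[of e'] xy)
    qed
    show "0 \<in> ideal_gen ?G"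
      using \<rho>_in[of 0] by simp
  qed (auto intro: ideal_gen_add ideal_gen_mult)
  moreover have "ideal_gen ?G \<subseteq> toric_ideal ?C"
  proof (rule toric_ideal_ideal_gen, intro Un_least)
    show "?SA \<subseteq> toric_ideal ?C"
      by (rule alg_hom_toric_ideal_subset)
         (simp add: alg_hom_diff alg_hom_Inl_monomial monomial_diff_in_toric_ideal deg)
    show "?SB \<subseteq> toric_ideal ?C"
      by (rule alg_hom_toric_ideal_subset)
         (simp add: alg_hom_diff alg_hom_Inr_monomial monomial_diff_in_toric_ideal deg)
    show "{\<rho>} \<subseteq> toric_ideal ?C"
      using rel by (simp add: \<rho> monomial_diff_in_toric_ideal deg)
  qed
  ultimately show ?thesis by (simp only: ideal_gen_Un[symmetric])
qed

section \<open>Bezout coefficients and natural combinations\<close>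

text \<open>Induction: the two-term identity for the new number and the old gcd rescales the old
  coefficients by \<open>t\<close>.\<close>

lemma bezout_finite_nat:
  assumes "finite S"
  shows "\<exists>z :: 'a \<Rightarrow> int. (\<Sum>j\<in>S. z j * int (u j)) = int (Gcd (u ` S))"
  using assms
proof induction
  case (insert j S)
  then obtain z where z: "(\<Sum>j\<in>S. z j * int (u j)) = int (Gcd (u ` S))" by blast
  obtain r t where "r * int (u j) + t * int (Gcd (u ` S)) = gcd (int (u j)) (int (Gcd (u ` S)))"
    using bezout_int by blast
  then have "r * int (u j) + (\<Sum>i\<in>S. (t * z i) * int (u i)) = int (Gcd (u ` insert j S))"
    by (simp add: z sum_distrib_left[symmetric] mult.assoc gcd_int_int_eq)
  moreover have "(\<Sum>i\<in>S. (t * z i) * int (u i)) = (\<Sum>i\<in>S. (if i = j then r else t * z i) * int (u i))"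
    using insert.hyps by (intro sum.cong) auto
  ultimately show ?case
    using insert.hyps by (intro exI[of _ "\<lambda>i. if i = j then r else t * z i"]) simp
qed simp

text \<open>The gcd itself need not be a combination with natural coefficients. A multiple with
  factor \<open>N\<close> coprime to \<open>e\<close> serves as well, because
  \<open>N dvd m * e\<close> then still yields \<open>N dvd m\<close>.\<close>

lemma coprime_multiple_of_Gcd:
  fixes u :: "'q::finite \<Rightarrow> nat" and e :: nat
  assumes "u j0 > 0" "e > 0"
  obtains \<beta> N where "(\<Sum>j\<in>UNIV. \<beta> j * u j) = N * Gcd (range u)" "coprime N e" "N > 0"
proof -
  define g where "g = Gcd (range u)"
  have g_dvd: "g dvd u j" for j by (simp add: g_def)
  have g_pos: "g > 0" using assms(1) g_dvd[of j0] by (auto intro: Nat.gr0I)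
  obtain z :: "'q \<Rightarrow> int" where z: "(\<Sum>j\<in>UNIV. z j * int (u j)) = int g"
    using bezout_finite_nat[of "UNIV :: 'q set" u] unfolding g_def by auto
  txt \<open>Positive residues of the Bezout coefficients modulo \<open>e\<close>; hence \<open>N\<close> is \<open>1\<close> modulo \<open>e\<close>.\<close>
  define \<beta> where "\<beta> j = nat (z j mod int e) + e" for j
  define N where "N = (\<Sum>j\<in>UNIV. \<beta> j * (u j div g))"
  \<comment> \<open>Each coefficient is raised by a multiple of \<open>e\<close>; \<open>M\<close>
    is the total correction, so that N = 1 + eM.\<close>
  define M where "M = (\<Sum>j\<in>UNIV. (1 - z j div int e) * int (u j div g))"
  have \<beta>: "int (\<beta> j) = z j + int e * (1 - z j div int e)" for j
  proof -
    have "int (nat (z j mod int e)) = z j - int e * (z j div int e)"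
      using assms(2) by (simp add: minus_mult_div_eq_mod)
    then show ?thesis by (simp add: \<beta>_def algebra_simps)
  qed
  have N: "(\<Sum>j\<in>UNIV. \<beta> j * u j) = N * g"
    by (simp add: N_def sum_distrib_right mult.assoc g_dvd)
  have "int g * (\<Sum>j\<in>UNIV. z j * int (u j div g)) = int g"
  proof -
    have "z j * int (u j) = int g * (z j * int (u j div g))" for j
      by (metis dvd_mult_div_cancel g_dvd mult.left_commute of_nat_mult)
    then have "int g * (\<Sum>j\<in>UNIV. z j * int (u j div g)) = (\<Sum>j\<in>UNIV. z j * int (u j))"
      by (simp only: sum_distrib_left)
    with z show ?thesis by simp
  qed
  then have "(\<Sum>j\<in>UNIV. z j * int (u j div g)) = 1" using g_pos by simp
  then have NM: "int N = 1 + int e * M"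
    by (simp add: N_def M_def \<beta> distrib_right sum.distrib sum_distrib_left mult.assoc)
  have "coprime (int N) (int e)"
    by (rule coprimeI) (metis NM dvd_add_left_iff dvd_mult2)
  then have "coprime N e" by simp
  moreover have "N > 0"
  proof -
    \<comment> \<open>The summand \<open>e\<close> in \<beta> matters here: the residue alone could
      be 0.\<close>
    have "\<beta> j0 * (u j0 div g) > 0"
      using assms g_dvd[of j0] g_pos by (simp add: \<beta>_def dvd_imp_le div_greater_zero_iff)
    also have "\<beta> j0 * (u j0 div g) \<le> N" unfolding N_def by (rule member_le_sum) auto
    finally show ?thesis .
  qed
  ultimately show ?thesis using N that unfolding g_def by blast
qed

section \<open>Semigroup elements as multidegrees\<close>

text \<open>One side sums over vectors, the other over indices, and vectors may repeat. A vector's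
  coefficient is given to the one index chosen by \<open>inv a\<close>; conversely, coefficients are
  added over all indices of a vector.\<close>

lemma semigroup_gen_range:
  fixes a :: "'v::finite \<Rightarrow> nat ^ 'n"
  shows "semigroup_gen (range a) = range (vdeg a)"
proof (intro equalityI subsetI)
  fix w assume "w \<in> semigroup_gen (range a)"
  then obtain c :: "nat ^ 'n \<Rightarrow> nat" where w: "w = (\<Sum>v\<in>range a. c v *s v)"
    by (auto simp: semigroup_gen_def)
  let ?I = "inv a ` range a"
  have "w = (\<Sum>v\<in>range a. c (a (inv a v)) *s a (inv a v))"
    unfolding w by (intro sum.cong) (auto simp: f_inv_into_f)
  also have "\<dots> = (\<Sum>i\<in>?I. c (a i) *s a i)"
    by (subst sum.reindex) (auto intro: inj_on_inv_into)
  also have "\<dots> = vdeg a (\<lambda>i. if i \<in> ?I then c (a i) else 0)"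
    unfolding vdeg_def by (rule sum.mono_neutral_cong_left) (auto simp: vec_eq_iff)
  finally show "w \<in> range (vdeg a)" by blast
next
  fix w assume "w \<in> range (vdeg a)"
  then obtain e where w: "w = (\<Sum>i\<in>UNIV. e i *s a i)" by (auto simp: vdeg_def)
  have "w = (\<Sum>v\<in>range a. \<Sum>i\<in>{i\<in>UNIV. a i = v}. e i *s a i)"
    unfolding w by (rule sum.image_gen) simp
  also have "\<dots> = (\<Sum>v\<in>range a. (\<Sum>i\<in>{i\<in>UNIV. a i = v}. e i) *s v)"
    by (rule sum.cong) (auto simp: vec_eq_iff sum_distrib_right)
  finally show "w \<in> semigroup_gen (range a)"
    unfolding semigroup_gen_def by (intro CollectI exI conjI TrueI)
qed

section \<open>Necessity and sufficiency of the multiple of b\<close>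

lemma gluing_relation:
  fixes A :: "nat ^ 'p ^ 'n" and B :: "nat ^ 'q ^ 'n"
  assumes "is_gluing TYPE('k::field) k1 k2 A B"
    and "k1 \<ge> 1" "\<And>i. column i A \<noteq> 0"
  obtains \<alpha> \<beta> where "k1 *s vdeg (\<lambda>i. column i A) \<alpha> = k2 *s vdeg (\<lambda>j. column j B) \<beta>"
    "\<beta> \<noteq> (\<lambda>_. 0)"
proof -
  let ?a = "\<lambda>i. column i A" and ?c = "\<lambda>j. column j B"
  let ?C = "case_sum (\<lambda>i. k1 *s ?a i) (\<lambda>j. k2 *s ?c j)"
  from assms(1) obtain \<alpha> \<beta> and \<rho> :: "('p + 'q, 'k) mpoly" where
    \<rho>: "\<rho> = monomial (case_sum \<alpha> (\<lambda>_. 0)) - monomial (case_sum (\<lambda>_. 0) \<beta>)" "\<rho> \<noteq> 0"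
    and I: "toric_ideal ?C = ideal_gen (alg_hom (\<lambda>i. Var (Inl i)) ` toric_ideal ?a) +
         ideal_gen (alg_hom (\<lambda>j. Var (Inr j)) ` toric_ideal ?c) + ideal_gen {\<rho>}"
    by (auto simp: is_gluing_def prod_Var_Inl prod_Var_Inr)
  have "\<rho> \<in> toric_ideal ?C"
    unfolding I ideal_gen_Un[symmetric] by (rule ideal_gen_base) simp
  then have rel: "k1 *s vdeg ?a \<alpha> = k2 *s vdeg ?c \<beta>"
    by (simp add: \<rho> monomial_diff_in_toric_ideal vdeg_case_sum vdeg_scale)
  \<comment> \<open>If \<beta> vanished, \<alpha> would have degree 0 and vanish too, making \<rho>
    = 1 - 1.\<close>
  have "\<beta> \<noteq> (\<lambda>_. 0)"
  proof
    assume \<beta>: "\<beta> = (\<lambda>_. 0)"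
    with rel have "vdeg ?a \<alpha> = 0" using assms(2) by (simp add: vec_eq_iff)
    then have "\<alpha> = (\<lambda>_. 0)" using vdeg_eq_0_iff[of ?a] assms(3) by blast
    with \<beta> \<rho> show False by simp
  qed
  with rel that show ?thesis by blast
qed

lemma is_gluing_of_multiple:
  fixes A :: "nat ^ 'p ^ 'n" and B :: "nat ^ 'q ^ 'n"
  assumes B_nonzero: "\<And>j. column j B \<noteq> 0" and B_line: "\<And>j. column j B = u j *s b"
    and d: "d \<ge> 1" and X: "vdeg (\<lambda>i. column i A) X = d *s b"
  shows "\<exists>k1. k1 \<ge> 1 \<and> is_gluing TYPE('k::field) k1 d A B"
proof -
  let ?a = "\<lambda>i. column i A" and ?c = "\<lambda>j. column j B"
  have vdegB: "vdeg ?c y = (\<Sum>j\<in>UNIV. y j * u j) *s b" for y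
    by (simp add: vec_eq_iff vdeg_nth B_line sum_distrib_right mult.assoc)
  \<comment> \<open>Any column of B will do, and \<open>undefined\<close> names one; its being
    nonzero forces b to be nonzero.\<close>
  obtain i0 where i0: "b $ i0 > 0"
    using B_nonzero[of undefined] by (auto simp: B_line vec_eq_iff)
  have u_pos: "u j > 0" for j
    using B_nonzero[of j] by (auto simp: B_line vec_eq_iff)
  define g where "g = Gcd (range u)"
  have g_dvd: "g dvd u j" for j by (simp add: g_def)
  have g_pos: "g > 0" using u_pos g_dvd by (metis dvd_0_left_iff gr0I)
  \<comment> \<open>In coordinate \<open>i0\<close> the relation shows that \<open>N\<close> divides
    \<open>m * e\<close>, which is why \<open>N\<close> is made coprime to this number.\<close>
  define e where "e = d * b $ i0"
  have e: "e > 0" using d i0 by (simp add: e_def)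
  obtain \<beta> N where \<beta>: "(\<Sum>j\<in>UNIV. \<beta> j * u j) = N * g" and N: "coprime N e" "N > 0"
    using coprime_multiple_of_Gcd[of u undefined e, OF u_pos e] unfolding g_def by blast
  have vdeg\<beta>: "vdeg ?c \<beta> = (N * g) *s b" by (simp add: vdegB \<beta>)
  \<comment> \<open>Ordering the B-degrees keeps the differences \<open>m\<close> and
    \<open>l\<close> natural; the opposite order follows by symmetry.\<close>
  have step: "\<exists>l. vdeg ?a x = vdeg ?a x' + l *s vdeg ?a X \<and> vdeg ?c y' = vdeg ?c y + l *s vdeg ?c \<beta>"
    if eq: "(N * g) *s vdeg ?a x + d *s vdeg ?c y = (N * g) *s vdeg ?a x' + d *s vdeg ?c y'"
      and le: "(\<Sum>j\<in>UNIV. y j * u j) \<le> (\<Sum>j\<in>UNIV. y' j * u j)" for x x' y y'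
  proof -
    \<comment> \<open>Both B-degrees are multiples of \<open>g *s b\<close>, with factors
      \<open>V\<close> and \<open>V'\<close>; this lets \<open>g\<close> be cancelled from the
      relation.\<close>
    define V V' where "V = (\<Sum>j\<in>UNIV. y j * u j) div g" and "V' = (\<Sum>j\<in>UNIV. y' j * u j) div g"
    have V: "(\<Sum>j\<in>UNIV. y j * u j) = g * V" "(\<Sum>j\<in>UNIV. y' j * u j) = g * V'"
      unfolding V_def V'_def by (intro dvd_mult_div_cancel[symmetric] dvd_sum dvd_mult g_dvd)+
    have "V \<le> V'"
      using le g_pos unfolding V by simp
    then obtain m where m: "V' = V + m"
      using le_Suc_ex by blast
    have coord: "N * vdeg ?a x $ i = N * vdeg ?a x' $ i + d * m * b $ i" for i
    proof -
      have "(N * g) * vdeg ?a x $ i + d * (g * V * b $ i) = (N * g) * vdeg ?a x' $ i + d * (g * V' * b $ i)"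
        using arg_cong[OF eq, of "\<lambda>v. v $ i"] by (simp add: vdegB V)
      then have "g * (N * vdeg ?a x $ i) = g * (N * vdeg ?a x' $ i + d * m * b $ i)"
        unfolding m by (simp add: algebra_simps)
      then show ?thesis using g_pos by simp
    qed
    have "N dvd N * vdeg ?a x' $ i0 + m * e"
      using coord[of i0] by (metis dvd_triv_left e_def mult.assoc mult.commute)
    then have "N dvd m * e" by (simp only: dvd_add_right_iff dvd_triv_left)
    then obtain l where l: "m = N * l"
      using N(1) by (auto simp: coprime_dvd_mult_left_iff)
    have "N * vdeg ?a x $ i = N * (vdeg ?a x' $ i + l * (d * b $ i))" for i
      using coord[of i] unfolding l by (simp add: algebra_simps)
    then have "vdeg ?a x $ i = vdeg ?a x' $ i + l * (d * b $ i)" for i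
      using N(2) by simp
    then have "vdeg ?a x = vdeg ?a x' + l *s vdeg ?a X"
      by (simp add: vec_eq_iff X)
    moreover have "vdeg ?c y' = vdeg ?c y + l *s vdeg ?c \<beta>"
      unfolding vdegB V m l \<beta> by (simp add: vec_eq_iff algebra_simps)
    ultimately show ?thesis by blast
  qed
  define \<rho> :: "('p + 'q, 'k) mpoly" where
    "\<rho> = monomial (case_sum X (\<lambda>_. 0)) - monomial (case_sum (\<lambda>_. 0) \<beta>)"
  \<comment> \<open>A monomial in x equals one in y only if both are 1, but the weighted sum of
    \<beta> is N g > 0.\<close>
  have "\<rho> \<noteq> 0"
  proof
    assume "\<rho> = 0"
    then have "case_sum X (\<lambda>_. 0) = case_sum (\<lambda>_. 0) \<beta>"
      unfolding \<rho>_def by (simp only: right_minus_eq monomial_inj)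
    then have "\<beta> = (\<lambda>_. 0)" by (metis old.sum.simps(6))
    with \<beta> N g_pos show False by simp
  qed
  moreover have "toric_ideal (case_sum (\<lambda>i. (N * g) *s ?a i) (\<lambda>j. d *s ?c j)) =
    ideal_gen (alg_hom (\<lambda>i. Var (Inl i)) ` toric_ideal ?a) +
    ideal_gen (alg_hom (\<lambda>j. Var (Inr j)) ` toric_ideal ?c) + ideal_gen {\<rho>}"
  proof (rule toric_ideal_gluing[OF \<rho>_def])
    show "(N * g) *s vdeg ?a X = d *s vdeg ?c \<beta>"
      by (simp add: X vdeg\<beta> vec_eq_iff)
  next
    fix x x' y y'
    assume eq: "(N * g) *s vdeg ?a x + d *s vdeg ?c y = (N * g) *s vdeg ?a x' + d *s vdeg ?c y'"
    show "\<exists>l. vdeg ?a x = vdeg ?a x' + l *s vdeg ?a X \<and> vdeg ?c y' = vdeg ?c y + l *s vdeg ?c \<beta> \<or>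
          vdeg ?a x' = vdeg ?a x + l *s vdeg ?a X \<and> vdeg ?c y = vdeg ?c y' + l *s vdeg ?c \<beta>"
    proof (cases "(\<Sum>j\<in>UNIV. y j * u j) \<le> (\<Sum>j\<in>UNIV. y' j * u j)")
      case True
      then show ?thesis using step[OF eq] by blast
    next
      case False
      then show ?thesis using step[OF eq[symmetric]] by force
    qed
  qed
  ultimately have "is_gluing TYPE('k) (N * g) d A B"
    unfolding is_gluing_def prod_Var_Inl prod_Var_Inr using \<rho>_def by blast
  then show ?thesis using N g_pos by (intro exI[of _ "N * g"]) simp
qed

section \<open>The equivalence of the three conditions\<close>

theorem theorem4p4:
  fixes A :: "nat ^ 'p ^ 'n" and B :: "nat ^ 'q ^ 'n"
    and b :: "nat ^ 'n" and u :: "'q \<Rightarrow> nat"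
  assumes A_nonzero: "\<And>i. column i A \<noteq> 0"
    and B_nonzero: "\<And>j. column j B \<noteq> 0"
    and q_ge_2: "CARD('q) \<ge> 2"
    and B_line: "\<And>j. column j B = u j *s b"
  shows "(can_be_glued TYPE('k::field) A B \<longleftrightarrow>
            (\<exists>d::nat. d \<ge> 1 \<and> d *s b \<in> semigroup_gen (columns A))) \<and>
         ((\<exists>d::nat. d \<ge> 1 \<and> d *s b \<in> semigroup_gen (columns A)) \<longleftrightarrow>
            (\<exists>(d::nat) (X :: nat ^ 'p). d \<ge> 1 \<and> A *v X = d *s b))"
proof
  let ?a = "\<lambda>i. column i A"
  have gen: "semigroup_gen (columns A) = range (vdeg ?a)"
  proof -
    have "columns A = range ?a" by (auto simp: columns_def)
    then show ?thesis by (simp only: semigroup_gen_range)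
  qed
  have mult: "A *v X = vdeg ?a (($) X)" for X
    by (simp add: vec_eq_iff vdeg_nth matrix_vector_mult_def column_def mult.commute)
  show "can_be_glued TYPE('k) A B \<longleftrightarrow> (\<exists>d::nat. d \<ge> 1 \<and> d *s b \<in> semigroup_gen (columns A))"
  proof
    assume "can_be_glued TYPE('k) A B"
    then obtain k1 k2 where k: "k1 \<ge> 1" "k2 \<ge> 1" "is_gluing TYPE('k) k1 k2 A B"
      by (auto simp: can_be_glued_def)
    obtain \<alpha> \<beta> where rel: "k1 *s vdeg ?a \<alpha> = k2 *s vdeg (\<lambda>j. column j B) \<beta>" and "\<beta> \<noteq> (\<lambda>_. 0)"
      using gluing_relation[OF k(3,1) A_nonzero] by blast
    then obtain j where j: "\<beta> j > 0" by (auto simp: fun_eq_iff)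
    have "u j > 0" using B_nonzero[of j] by (auto simp: B_line vec_eq_iff)
    with j have "0 < \<beta> j * u j" by simp
    also have "\<dots> \<le> (\<Sum>j\<in>UNIV. \<beta> j * u j)" by (rule member_le_sum) auto
    finally have "k2 * (\<Sum>j\<in>UNIV. \<beta> j * u j) \<ge> 1" using k(2) by simp
    \<comment> \<open>The summand \<open>0\<close> brings the exponent into the form required by
      \<open>vdeg_add_mult\<close>.\<close>
    moreover have "(k2 * (\<Sum>j\<in>UNIV. \<beta> j * u j)) *s b = vdeg ?a (\<lambda>i. 0 + k1 * \<alpha> i)"
      unfolding vdeg_add_mult rel
      by (simp add: vec_eq_iff vdeg_nth B_line sum_distrib_right mult.assoc)
    ultimately show "\<exists>d::nat. d \<ge> 1 \<and> d *s b \<in> semigroup_gen (columns A)"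
      unfolding gen by blast
  next
    assume "\<exists>d::nat. d \<ge> 1 \<and> d *s b \<in> semigroup_gen (columns A)"
    then obtain d X where "d \<ge> 1" "vdeg ?a X = d *s b" unfolding gen by (metis imageE)
    then show "can_be_glued TYPE('k) A B"
      using is_gluing_of_multiple[OF B_nonzero B_line] unfolding can_be_glued_def by blast
  qed
  show "(\<exists>d::nat. d \<ge> 1 \<and> d *s b \<in> semigroup_gen (columns A)) \<longleftrightarrow>
      (\<exists>(d::nat) (X :: nat ^ 'p). d \<ge> 1 \<and> A *v X = d *s b)"
    unfolding gen mult image_iff by (metis UNIV_I vec_lambda_inverse)
qed

end
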